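(* For each strictly convex configuration $P$ of an equilateral pentagonal linkage $L$, there exists exactly one pair $(s,t)\in(0,\infty)\times(0,\infty)$ such that $P$ is a critical point of $E=E_{s,t}$ on $M(L)$.
   Context: An equilateral pentagonal (5-bar) linkage $L$ is given by five equal positive sidelengths $\ell$. Its moduli space is $M(L)=\{(p_1,\dots,p_5)\in(\mathbb{R}^2)^5 : |p_ip_{i+1}|=\ell\ (i=1,\dots,4),\ |p_5p_1|=\ell\}/\mathrm{Iso}(\mathbb{R}^2)$, the quotient by all isometries of the plane (including orientation-reversing ones); it is a smooth surface. A configuration is strictly convex if it is a convex pentagon with all angles less than $\pi$. Write $x_{ij}=|p_ip_j|$ for the lengths of diagonals. Charge $t$ is placed at $p_3$, charge $s$ at $p_5$, and charges $+1$ at $p_1,p_2,p_4$; the (effective) Coulomb potential is $E_{s,t}=\frac{1}{x_{14}}+\frac{1}{x_{24}}+\frac{t}{x_{13}}+\frac{s}{x_{25}}+\frac{st}{x_{35}}$, a smooth function on the open subset of $M(L)$ where these diagonals are nonzero (this subset contains all convex configurations). $P$ is a critical point if $dE_{s,t}=0$ at $P$. *)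

theory Defs
  imports "HOL-Analysis.Analysis"
begin

text \<open>
  Indices live in the numeral type \<^typ>\<open>5\<close>, where addition is modulo 5. So \<open>p $ (i + 1)\<close> is
  the cyclic successor of \<open>p $ i\<close>, and the fifth vertex \<open>p $ 5\<close> is also \<open>p $ 0\<close>.
\<close>

type_synonym configuration = "real^2^5"

definition config_space :: "real \<Rightarrow> configuration set" where
  "config_space l = {p. \<forall>i. dist (p $ i) (p $ (i + 1)) = l}"

definition plane_isometry :: "(real^2 \<Rightarrow> real^2) \<Rightarrow> bool" where
  "plane_isometry g \<longleftrightarrow> bij g \<and> (\<forall>x y. dist (g x) (g y) = dist x y)"

definition congruent_rel :: "real \<Rightarrow> (configuration \<times> configuration) set" where
  "congruent_rel l = {(p, q). p \<in> config_space l \<and> q \<in> config_space l \<and>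
     (\<exists>g. plane_isometry g \<and> (\<forall>i. q $ i = g (p $ i)))}"

definition moduli_space :: "real \<Rightarrow> configuration set set" where
  "moduli_space l = config_space l // congruent_rel l"

definition config_class :: "real \<Rightarrow> configuration \<Rightarrow> configuration set" where
  "config_class l p = congruent_rel l `` {p}"

lemma equiv_congruent_rel: "equiv (config_space l) (congruent_rel l)"
proof (rule equivI)
  show "congruent_rel l \<subseteq> config_space l \<times> config_space l"
    unfolding congruent_rel_def by blast
  show "refl_on (config_space l) (congruent_rel l)"
  proof (rule refl_onI)
    fix p assume "p \<in> config_space l"
    moreover have "plane_isometry id" "\<forall>i. p $ i = id (p $ i)"
      by (simp_all add: plane_isometry_def)
    ultimately show "(p, p) \<in> congruent_rel l"
      unfolding congruent_rel_def by blast
  qed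
  show "sym (congruent_rel l)"
  proof (rule symI)
    fix p q assume "(p, q) \<in> congruent_rel l"
    then obtain g where pq: "p \<in> config_space l" "q \<in> config_space l"
      and g: "plane_isometry g" "\<And>i. q $ i = g (p $ i)"
      unfolding congruent_rel_def by blast
    have "plane_isometry (inv g)"
      unfolding plane_isometry_def
    proof (intro conjI allI)
      have b: "bij g" and d: "\<And>x y. dist (g x) (g y) = dist x y"
        using g(1) by (auto simp: plane_isometry_def)
      show "bij (inv g)"
        using b by (rule bij_imp_bij_inv)
      show "dist (inv g x) (inv g y) = dist x y" for x y
        using d[of "inv g x" "inv g y"] b by (simp add: bij_is_surj surj_f_inv_f)
    qed
    moreover have "\<forall>i. p $ i = inv g (q $ i)"
      using g by (simp add: plane_isometry_def bij_is_inj)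
    ultimately show "(q, p) \<in> congruent_rel l"
      using pq unfolding congruent_rel_def by blast
  qed
  show "trans (congruent_rel l)"
  proof (rule transI)
    fix p q r assume "(p, q) \<in> congruent_rel l" "(q, r) \<in> congruent_rel l"
    then obtain g h where pr: "p \<in> config_space l" "r \<in> config_space l"
      and g: "plane_isometry g" "\<And>i. q $ i = g (p $ i)"
      and h: "plane_isometry h" "\<And>i. r $ i = h (q $ i)"
      unfolding congruent_rel_def by blast
    have "plane_isometry (h \<circ> g)"
      using g(1) h(1) by (simp add: plane_isometry_def bij_comp)
    moreover have "\<forall>i. r $ i = (h \<circ> g) (p $ i)"
      using g h by simp
    ultimately show "(p, r) \<in> congruent_rel l"
      using pr unfolding congruent_rel_def by blast
  qed
qed

definition diagonal :: "5 \<Rightarrow> 5 \<Rightarrow> configuration set \<Rightarrow> real" where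
  "diagonal i j P = the_elem ((\<lambda>p. dist (p $ i) (p $ j)) ` P)"

lemma diagonal_config_class:
  assumes "p \<in> config_space l"
  shows "diagonal i j (config_class l p) = dist (p $ i) (p $ j)"
proof -
  have self: "p \<in> config_class l p"
    unfolding config_class_def using equiv_congruent_rel assms by (rule equiv_class_self)
  have const: "dist (q $ i) (q $ j) = dist (p $ i) (p $ j)" if q: "q \<in> config_class l p" for q
  proof -
    from q obtain g where "plane_isometry g" "\<And>k. q $ k = g (p $ k)"
      unfolding config_class_def congruent_rel_def by blast
    then show ?thesis
      by (simp add: plane_isometry_def)
  qed
  have "(\<lambda>q. dist (q $ i) (q $ j)) ` config_class l p = (\<lambda>q. dist (p $ i) (p $ j)) ` config_class l p"
    using refl const by (rule image_cong)
  also have "\<dots> = {dist (p $ i) (p $ j)}"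
    using self by (rule image_constant)
  finally have "(\<lambda>q. dist (q $ i) (q $ j)) ` config_class l p = {dist (p $ i) (p $ j)}" .
  then show ?thesis
    by (simp add: diagonal_def)
qed

text \<open>
  Charge \<open>t\<close> at vertex 3, charge \<open>s\<close> at vertex 5, unit charges elsewhere. The terms of the five
  sides are constant and omitted. The value is meaningful only where all five diagonals are
  nonzero, which includes every strictly convex configuration.
\<close>

definition coulomb :: "real \<Rightarrow> real \<Rightarrow> configuration set \<Rightarrow> real" where
  "coulomb s t P = 1 / diagonal 1 4 P + 1 / diagonal 2 4 P + t / diagonal 1 3 P
     + s / diagonal 2 5 P + s * t / diagonal 3 5 P"

definition pentagon_path :: "configuration \<Rightarrow> real \<Rightarrow> real^2" where
  "pentagon_path p = linepath (p $ 1) (p $ 2) +++ linepath (p $ 2) (p $ 3) +++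
     linepath (p $ 3) (p $ 4) +++ linepath (p $ 4) (p $ 5) +++ linepath (p $ 5) (p $ 1)"

definition convex_pentagon :: "configuration \<Rightarrow> bool" where
  "convex_pentagon p \<longleftrightarrow>
     simple_path (pentagon_path p) \<and> convex (inside (path_image (pentagon_path p)))"

text \<open>
  The unoriented angle between the two sides at a vertex. In a convex polygon it is the
  interior angle.
\<close>

definition vertex_angle :: "configuration \<Rightarrow> 5 \<Rightarrow> real" where
  "vertex_angle p i = arccos (((p $ (i - 1) - p $ i) \<bullet> (p $ (i + 1) - p $ i)) /
     (norm (p $ (i - 1) - p $ i) * norm (p $ (i + 1) - p $ i)))"

definition strictly_convex :: "configuration set \<Rightarrow> bool" where
  "strictly_convex P \<longleftrightarrow> (\<exists>p\<in>P. convex_pentagon p \<and> (\<forall>i. vertex_angle p i < pi))"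

text \<open>
  For \<open>l > 0\<close> no configuration is collinear (a signed sum of five copies of \<open>l\<close> is nonzero), so
  the configuration space is a regular level set on which the isometry group acts freely and
  properly. The quotient map is thus a submersion, and every tangent vector of the moduli space
  is the velocity of the projection of a \<open>C\<^sup>1\<close> curve of configurations. The differential of a
  function applied to such a velocity is the derivative of the function along the curve.
\<close>

definition critical_point :: "real \<Rightarrow> (configuration set \<Rightarrow> real) \<Rightarrow> configuration set \<Rightarrow> bool" where
  "critical_point l f P \<longleftrightarrow> P \<in> moduli_space l \<and>
     (\<forall>\<gamma> e. e > 0 \<and> \<gamma> C1_differentiable_on {-e<..<e} \<and> \<gamma> ` {-e<..<e} \<subseteq> config_space l \<and>
        config_class l (\<gamma> 0) = P \<longrightarrow>
        ((\<lambda>r. f (config_class l (\<gamma> r))) has_real_derivative 0) (at 0))"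

end

theory Submission
  imports Defs
begin

text \<open>
Write \<open>D\<^sub>i\<^sub>j\<close> for the rate of change of the squared diagonal \<open>x\<^sub>i\<^sub>j\<close> along a motion of the linkage. The moduli
space is two-dimensional, and near a strictly convex pentagon the diagonals \<open>x\<^sub>1\<^sub>4\<close> and \<open>x\<^sub>2\<^sub>4\<close>, which carry
no charge parameter, serve as coordinates. Every other rate is therefore a linear combination of
\<open>D\<^sub>1\<^sub>4\<close> and \<open>D\<^sub>2\<^sub>4\<close>, and convexity fixes the signs:
\<open>D\<^sub>1\<^sub>3 = a D\<^sub>1\<^sub>4 - b D\<^sub>2\<^sub>4\<close>, \<open>D\<^sub>2\<^sub>5 = c D\<^sub>2\<^sub>4 - d D\<^sub>1\<^sub>4\<close>, \<open>D\<^sub>3\<^sub>5 = - f D\<^sub>1\<^sub>4 - g D\<^sub>2\<^sub>4\<close> with all six coefficients positive.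
(Opening one diagonal of a convex quadrilateral with rigid sides closes the other one.)
The derivative of the potential vanishes on all motions exactly if the coefficients of \<open>D\<^sub>1\<^sub>4\<close> and \<open>D\<^sub>2\<^sub>4\<close>
in it vanish, which gives two equations
\<open>s = (a\<^sub>1 + b\<^sub>1 t) / (c\<^sub>1 + d\<^sub>1 t)\<close> and \<open>t = (a\<^sub>2 + b\<^sub>2 s) / (c\<^sub>2 + d\<^sub>2 s)\<close> with positive coefficients. Eliminating \<open>s\<close> leaves
a quadratic equation for \<open>t\<close> with positive leading and negative constant coefficient, hence exactly one
positive root (\<open>coupled_fixed_point_unique\<close>).

Three ingredients carry the geometry. The Jordan--Brouwer theorem and a separating hyperplane show that
the line through a side of the pentagon supports it, so that all vertex triples in cyclic order have
the same orientation (\<open>strictly_convex_vertices_ordered\<close>). The affine dependence of four points in the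
plane yields a linear relation between the rates of their six distances
(\<open>path_quadrilateral_rates\<close>). Finally \<open>four_bar_flex\<close> constructs motions that change \<open>x\<^sub>1\<^sub>4\<close> alone and
\<open>x\<^sub>2\<^sub>4\<close> alone, so that \<open>D\<^sub>1\<^sub>4\<close> and \<open>D\<^sub>2\<^sub>4\<close> are independent (\<open>diagonal_rates\<close>).
\<close>

section \<open>Orientation of vertex triples\<close>

text \<open>
Twice the signed area of the triangle.
\<close>

definition orient :: "real^2 \<Rightarrow> real^2 \<Rightarrow> real^2 \<Rightarrow> real" where
  "orient a b c = (b$1 - a$1) * (c$2 - a$2) - (b$2 - a$2) * (c$1 - a$1)"

lemma dist_plane_sq: "(dist x y)\<^sup>2 = (x$1 - y$1)\<^sup>2 + (x$2 - y$2)\<^sup>2" for x y :: "real^2"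
  unfolding dist_norm power2_norm_eq_inner by (simp add: inner_vec_def sum_2 power2_eq_square)

lemma inner_plane: "x \<bullet> y = x$1 * y$1 + x$2 * y$2" for x y :: "real^2"
  by (simp add: inner_vec_def sum_2)

lemma plane_eq_iff: "x = y \<longleftrightarrow> x$1 = y$1 \<and> x$2 = y$2" for x y :: "real^2"
  by (simp add: vec_eq_iff forall_2)

lemma orient_rotate: "orient b c a = orient a b c"
  unfolding orient_def by algebra

section \<open>Sides of a convex loop support it\<close>

text \<open>
The complement of a Jordan curve has a bounded component, and by Jordan--Brouwer the whole curve
is the frontier of that component.
\<close>

lemma simple_loop_subset_closure_inside:
  fixes g :: "real \<Rightarrow> real^2"
  assumes "simple_path g" "pathfinish g = pathstart g"
  shows "path_image g \<subseteq> closure (inside (path_image g))"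
proof -
  let ?S = "path_image g"
  have "sphere (0::complex) 1 homeomorphic sphere (0::real^2) 1"
    by (rule homeomorphic_spheres_gen) auto
  then have hom: "?S homeomorphic sphere (0::real^2) 1"
    using homeomorphic_simple_path_image_circle[OF assms, of 1 0] homeomorphic_trans by fastforce
  have bdd: "bounded (- (- ?S))"
    using assms(1) by (simp add: bounded_simple_path_image)
  obtain T where T: "T \<in> components (- ?S)" "bounded T"
    using cobounded_has_bounded_component[OF bdd Jordan_Brouwer_separation[OF hom]] by auto
  have fr: "frontier T = ?S"
    using Jordan_Brouwer_frontier[OF hom T(1)] by simp
  have sub: "T \<subseteq> inside ?S"
  proof
    fix x assume "x \<in> T"
    moreover obtain y where "T = connected_component_set (- ?S) y"
      using T(1) unfolding components_iff by blast
    ultimately have "x \<notin> ?S" "connected_component_set (- ?S) x = T"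
      using in_components_subset[OF T(1)] connected_component_eq[of x "- ?S" y] by auto
    then show "x \<in> inside ?S"
      using T(2) by (simp add: inside_def)
  qed
  show "?S \<subseteq> closure (inside ?S)"
    using fr closure_mono[OF sub] by (auto simp: frontier_def)
qed

text \<open>
The midpoint of the side lies outside the open convex interior, so some closed half-plane through
it contains the interior and, by passing to the closure, the loop. Both endpoints of the side lie in
this half-plane while their average lies on its boundary line; hence that line is the line through
the side.
\<close>

lemma side_supports_convex_loop:
  fixes g :: "real \<Rightarrow> real^2"
  assumes "simple_path g" "pathfinish g = pathstart g" "convex (inside (path_image g))"
    and seg: "closed_segment a b \<subseteq> path_image g"
    and xy: "x \<in> path_image g" "y \<in> path_image g"
  shows "0 \<le> orient a b x * orient a b y"
proof (cases "a = b")
  case True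
  then show ?thesis by (simp add: orient_def)
next
  case False
  let ?I = "inside (path_image g)"
  define m where "m = midpoint a b"
  have "m \<in> closed_segment a b"
    by (simp add: m_def)
  then have "m \<notin> ?I"
    using seg inside_no_overlap[of "path_image g"] by blast
  then obtain n where n: "n \<noteq> 0" "\<And>z. z \<in> ?I \<Longrightarrow> 0 \<le> n \<bullet> (z - m)"
    using separating_hyperplane_set_0[of "(\<lambda>z. z - m) ` ?I"] assms(3)
    by (fastforce simp: convex_translation_subtract_eq)
  have "closed {z. 0 \<le> n \<bullet> (z - m)}"
    by (intro closed_Collect_le continuous_intros)
  then have "closure ?I \<subseteq> {z. 0 \<le> n \<bullet> (z - m)}"
    by (intro closure_minimal) (auto simp: n)
  then have n': "0 \<le> n \<bullet> (z - m)" if "z \<in> path_image g" for z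
    using simple_loop_subset_closure_inside[OF assms(1,2)] that by blast
  have "a \<in> path_image g" "b \<in> path_image g"
    using seg by auto
  then have "0 \<le> n \<bullet> (a - m)" "0 \<le> n \<bullet> (b - m)"
    using n' by auto
  then have perp: "n$1 * (b$1 - a$1) + n$2 * (b$2 - a$2) = 0"
    and am: "n \<bullet> (a - m) = 0"
    by (auto simp: inner_plane m_def midpoint_def field_simps)
  (* The normal n is perpendicular to b - a, hence c / q times b - a turned by a right angle. *)
  define q where "q = (b$1 - a$1)\<^sup>2 + (b$2 - a$2)\<^sup>2"
  define c where "c = (b$1 - a$1) * n$2 - (b$2 - a$2) * n$1"
  have q: "q > 0"
    using False unfolding q_def by (auto simp: plane_eq_iff sum_power2_gt_zero_iff)
  have qn: "q * n$1 = - c * (b$2 - a$2)" "q * n$2 = c * (b$1 - a$1)"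
    using perp unfolding q_def c_def by algebra+
  have c: "c \<noteq> 0"
    using n(1) q qn by (auto simp: plane_eq_iff)
  have key: "q * (n \<bullet> (z - m)) = c * orient a b z" for z
  proof -
    have "n \<bullet> (z - m) = n \<bullet> (z - a)"
      using am by (simp add: inner_diff_right)
    then show ?thesis
      using qn unfolding inner_plane orient_def vector_minus_component by algebra
  qed
  have "0 \<le> c * orient a b x" "0 \<le> c * orient a b y"
    using n'[OF xy(1)] n'[OF xy(2)] q key by (metis mult_nonneg_nonneg less_imp_le)+
  then have "0 \<le> (c * orient a b x) * (c * orient a b y)"
    by simp
  then have "0 \<le> c\<^sup>2 * (orient a b x * orient a b y)"
    by (simp add: power2_eq_square algebra_simps)
  then show ?thesis
    using c by (simp add: zero_le_mult_iff)
qed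

text \<open>
If the vertex \<open>d\<close> opposite to the side \<open>ab\<close> of the pentagon \<open>abcde\<close> lay on the line \<open>ab\<close>, at
\<open>a + \<mu> (b - a)\<close>, then \<open>a\<close> and \<open>d\<close> would be strictly separated by the line \<open>bc\<close> for \<open>\<mu> > 1\<close>, \<open>b\<close> and \<open>d\<close>
by the line \<open>ea\<close> for \<open>\<mu> < 0\<close>, and \<open>a\<close> and \<open>b\<close> by the line \<open>de\<close> for \<open>0 < \<mu> < 1\<close>. The values
\<open>0\<close> and \<open>1\<close> would make \<open>d\<close> coincide with \<open>a\<close> or \<open>b\<close>.
\<close>

lemma opposite_vertex_off_side_line:
  assumes abc: "orient a b c \<noteq> 0" and eab: "orient e a b \<noteq> 0"
    and bc: "0 \<le> orient b c a * orient b c d"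
    and ea: "0 \<le> orient e a b * orient e a d"
    and de: "0 \<le> orient d e a * orient d e b"
    and dist: "d \<noteq> a" "d \<noteq> b"
  shows "orient a b d \<noteq> 0"
proof
  assume 0: "orient a b d = 0"
  define q where "q = (b$1 - a$1)\<^sup>2 + (b$2 - a$2)\<^sup>2"
  define \<mu> where "\<mu> = ((b$1 - a$1) * (d$1 - a$1) + (b$2 - a$2) * (d$2 - a$2)) / q"
  have "a \<noteq> b"
    using abc by (auto simp: orient_def)
  then have q: "q > 0"
    unfolding q_def by (auto simp: plane_eq_iff sum_power2_gt_zero_iff)
  then have q\<mu>: "q * \<mu> = (b$1 - a$1) * (d$1 - a$1) + (b$2 - a$2) * (d$2 - a$2)"
    by (simp add: \<mu>_def)
  have "q * (d$1 - a$1) = q * (\<mu> * (b$1 - a$1))" "q * (d$2 - a$2) = q * (\<mu> * (b$2 - a$2))"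
    using 0 q\<mu> unfolding q_def orient_def by algebra+
  then have d: "d$1 = a$1 + \<mu> * (b$1 - a$1)" "d$2 = a$2 + \<mu> * (b$2 - a$2)"
    using q by auto
  have "orient b c a * orient b c d = (1 - \<mu>) * (orient a b c)\<^sup>2"
    unfolding orient_def d by algebra
  then have le1: "\<mu> \<le> 1"
    using bc abc by (simp add: zero_le_mult_iff)
  have "orient e a b * orient e a d = \<mu> * (orient e a b)\<^sup>2"
    unfolding orient_def d by algebra
  then have ge0: "0 \<le> \<mu>"
    using ea eab by (simp add: zero_le_mult_iff)
  have "orient d e a * orient d e b = - (\<mu> * (1 - \<mu>)) * (orient e a b)\<^sup>2"
    unfolding orient_def d by algebra
  then have "0 \<le> - (\<mu> * (1 - \<mu>))"
    using de eab mult_neg_pos[of "- (\<mu> * (1 - \<mu>))" "(orient e a b)\<^sup>2"] by fastforce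
  then have "\<mu> = 0 \<or> \<mu> = 1"
    using le1 ge0 mult_pos_pos[of \<mu> "1 - \<mu>"] by linarith
  then show False
    using d dist by (auto simp: plane_eq_iff)
qed

section \<open>Orientation pattern of strictly convex pentagons\<close>

lemma pentagon_path_image:
  "path_image (pentagon_path p) = closed_segment (p$1) (p$2) \<union> closed_segment (p$2) (p$3) \<union>
     closed_segment (p$3) (p$4) \<union> closed_segment (p$4) (p$5) \<union> closed_segment (p$5) (p$1)"
  unfolding pentagon_path_def by (simp add: path_image_join Un_assoc)

text \<open>
Since \<open>+++\<close> associates to the right, the parameter interval is halved at each join.
\<close>

lemma pentagon_path_at_vertices:
  "pentagon_path p 0 = p$1" "pentagon_path p (1/2) = p$2" "pentagon_path p (3/4) = p$3"
  "pentagon_path p (7/8) = p$4" "pentagon_path p (15/16) = p$5"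
  unfolding pentagon_path_def joinpaths_def by (simp_all add: linepath_def)

lemma simple_pentagon_vertices_distinct:
  assumes "simple_path (pentagon_path p)"
  shows "p$1 \<noteq> p$3" "p$1 \<noteq> p$4" "p$2 \<noteq> p$4" "p$2 \<noteq> p$5" "p$3 \<noteq> p$5"
proof -
  have *: "pentagon_path p x \<noteq> pentagon_path p y" if "0 \<le> x" "x < y" "y < 1" for x y
    using assms that unfolding simple_path_def loop_free_def by force
  show "p$1 \<noteq> p$3" "p$1 \<noteq> p$4" "p$2 \<noteq> p$4" "p$2 \<noteq> p$5" "p$3 \<noteq> p$5"
    using *[of 0 "3/4"] *[of 0 "7/8"] *[of "1/2" "7/8"] *[of "1/2" "15/16"] *[of "3/4" "15/16"]
    by (simp_all add: pentagon_path_at_vertices)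
qed

text \<open>
Collinear arms of equal length either coincide, which \<open>a \<noteq> c\<close> excludes, or enclose the angle \<open>\<pi>\<close>.
\<close>

lemma equal_arms_not_collinear:
  fixes a b c :: "real^2"
  assumes "l > 0" "dist a b = l" "dist b c = l" "a \<noteq> c"
    and ang: "arccos (((a - b) \<bullet> (c - b)) / (norm (a - b) * norm (c - b))) < pi"
  shows "orient a b c \<noteq> 0"
proof
  assume 0: "orient a b c = 0"
  have nrm: "norm (a - b) = l" "norm (c - b) = l"
    using assms(2,3) by (simp_all add: dist_norm norm_minus_commute)
  have sq: "(a$1 - b$1)\<^sup>2 + (a$2 - b$2)\<^sup>2 = l\<^sup>2" "(b$1 - c$1)\<^sup>2 + (b$2 - c$2)\<^sup>2 = l\<^sup>2"
    using assms(2,3) dist_plane_sq by metis+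
  have "((a - b) \<bullet> (c - b))\<^sup>2 = (l\<^sup>2)\<^sup>2"
    using 0 sq unfolding inner_plane orient_def vector_minus_component by algebra
  then consider "(a - b) \<bullet> (c - b) = l\<^sup>2" | "(a - b) \<bullet> (c - b) = - l\<^sup>2"
    using power2_eq_iff by blast
  then show False
  proof cases
    case 1
    have "(dist a c)\<^sup>2 = 0"
      using 1 sq unfolding dist_plane_sq inner_plane vector_minus_component by algebra
    then show False
      using assms(4) by simp
  next
    case 2
    then show False
      using ang assms(1) nrm by (simp add: power2_eq_square)
  qed
qed

lemma exhaust_5: "x = 1 \<or> x = 2 \<or> x = 3 \<or> x = 4 \<or> x = 5" for x :: 5
proof (induct x)
  case (of_int z)
  then have "0 \<le> z" "z < 5" by simp_all
  then have "z = 0 \<or> z = 1 \<or> z = 2 \<or> z = 3 \<or> z = 4" by arith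
  then show ?case by auto
qed

lemma forall_5: "(\<forall>i::5. Q i) \<longleftrightarrow> Q 1 \<and> Q 2 \<and> Q 3 \<and> Q 4 \<and> Q 5"
  by (metis exhaust_5)

lemma succ_5: "(1::5) + 1 = 2" "(2::5) + 1 = 3" "(3::5) + 1 = 4" "(4::5) + 1 = 5" "(5::5) + 1 = 1"
  by simp_all

lemma pred_5: "(1::5) - 1 = 5" "(2::5) - 1 = 1" "(3::5) - 1 = 2" "(4::5) - 1 = 3" "(5::5) - 1 = 4"
  by simp_all

lemma mem_config_space_iff:
  "p \<in> config_space l \<longleftrightarrow> dist (p$1) (p$2) = l \<and> dist (p$2) (p$3) = l \<and> dist (p$3) (p$4) = l \<and>
     dist (p$4) (p$5) = l \<and> dist (p$5) (p$1) = l"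
  unfolding config_space_def mem_Collect_eq forall_5 succ_5 ..

text \<open>
The sign of \<open>\<epsilon>\<close> records whether the vertices run counterclockwise or clockwise.
\<close>

definition convexly_ordered :: "real \<Rightarrow> real^2 \<Rightarrow> real^2 \<Rightarrow> real^2 \<Rightarrow> real^2 \<Rightarrow> real^2 \<Rightarrow> bool" where
  "convexly_ordered \<epsilon> a b c d e \<longleftrightarrow>
     0 < \<epsilon> * orient a b c \<and> 0 < \<epsilon> * orient a b d \<and> 0 < \<epsilon> * orient a b e \<and> 0 < \<epsilon> * orient a c d \<and>
     0 < \<epsilon> * orient a c e \<and> 0 < \<epsilon> * orient a d e \<and> 0 < \<epsilon> * orient b c d \<and> 0 < \<epsilon> * orient b c e \<and>
     0 < \<epsilon> * orient b d e \<and> 0 < \<epsilon> * orient c d e"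

text \<open>
Each triple of vertices contains a side, and the side's supporting line puts the three remaining
vertices on one side, strictly because no other vertex lies on it. Two consecutive sides agree in
sign as they share the triple at their common vertex.
\<close>

lemma strictly_convex_vertices_ordered:
  assumes "l > 0" "p \<in> config_space l" "convex_pentagon p" and ang: "\<forall>i. vertex_angle p i < pi"
  shows "\<exists>\<epsilon>. convexly_ordered \<epsilon> (p$1) (p$2) (p$3) (p$4) (p$5)"
proof -
  let ?g = "pentagon_path p"
  define a b c d e where "a = p$1" and "b = p$2" and "c = p$3" and "d = p$4" and "e = p$5"
  note abcde = this
  have sides: "dist a b = l" "dist b c = l" "dist c d = l" "dist d e = l" "dist e a = l"
    using assms(2) unfolding mem_config_space_iff abcde by auto
  have simple: "simple_path ?g" "pathfinish ?g = pathstart ?g" and conv: "convex (inside (path_image ?g))"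
    using assms(3) unfolding convex_pentagon_def by (auto simp: pentagon_path_def)
  note ne = simple_pentagon_vertices_distinct[OF simple(1), folded abcde]
  note angs = ang[unfolded forall_5 vertex_angle_def succ_5 pred_5, folded abcde]
  have corners: "orient e a b \<noteq> 0" "orient a b c \<noteq> 0" "orient b c d \<noteq> 0" "orient c d e \<noteq> 0" "orient d e a \<noteq> 0"
    using sides ne angs equal_arms_not_collinear[OF assms(1)] by auto
  have mem: "a \<in> path_image ?g" "b \<in> path_image ?g" "c \<in> path_image ?g" "d \<in> path_image ?g" "e \<in> path_image ?g"
    unfolding pentagon_path_image abcde by auto
  have supp: "0 \<le> orient a b x * orient a b y" "0 \<le> orient b c x * orient b c y"
     "0 \<le> orient c d x * orient c d y" "0 \<le> orient d e x * orient d e y" "0 \<le> orient e a x * orient e a y"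
    if "x \<in> path_image ?g" "y \<in> path_image ?g" for x y
    using that by (auto intro!: side_supports_convex_loop[OF simple conv] simp: pentagon_path_image abcde)
  have opp: "orient a b d \<noteq> 0" "orient b c e \<noteq> 0" "orient c d a \<noteq> 0" "orient d e b \<noteq> 0" "orient e a c \<noteq> 0"
    using opposite_vertex_off_side_line[of a b c e d] opposite_vertex_off_side_line[of b c d a e]
      opposite_vertex_off_side_line[of c d e b a] opposite_vertex_off_side_line[of d e a c b]
      opposite_vertex_off_side_line[of e a b d c] corners ne mem
    by (simp_all add: supp)
  have strict: "0 < x * y" if "0 \<le> x * y" "x \<noteq> 0" "y \<noteq> 0" for x y :: real
    using that by (simp add: order.order_iff_strict)
  have rotated: "orient a b e \<noteq> 0" "orient b c a \<noteq> 0" "orient c d b \<noteq> 0" "orient d e c \<noteq> 0"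
    using corners by (simp_all only: orient_rotate[of a b e] orient_rotate[of b c a] orient_rotate[of c d b] orient_rotate[of d e c] not_False_eq_True)
  have "0 < orient a b c * orient a b d" "0 < orient a b c * orient a b e"
     "0 < orient b c d * orient b c e" "0 < orient b c d * orient b c a"
     "0 < orient c d e * orient c d a" "0 < orient c d e * orient c d b"
     "0 < orient d e a * orient d e b" "0 < orient d e a * orient d e c"
     "0 < orient e a b * orient e a c"
    by (intro strict supp mem corners opp rotated)+
  then have pos: "0 < orient a b c * orient a b d" "0 < orient a b c * orient a b e"
     "0 < orient b c d * orient b c e" "0 < orient b c d * orient a b c"
     "0 < orient c d e * orient a c d" "0 < orient c d e * orient b c d"
     "0 < orient a d e * orient b d e" "0 < orient a d e * orient c d e"
     "0 < orient a b e * orient a c e"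
    by (simp_all only: orient_rotate[of b c a] orient_rotate[of c d a] orient_rotate[of c d b] orient_rotate[of d e a] orient_rotate[of d e b] orient_rotate[of d e c] orient_rotate[of a b e, symmetric] orient_rotate[of a c e, symmetric])
  have "convexly_ordered (orient a b c) a b c d e"
    using pos unfolding convexly_ordered_def zero_less_mult_iff by linarith
  then show ?thesis
    unfolding abcde by blast
qed

section \<open>Two coupled Moebius equations\<close>

lemma coupled_fixed_point_unique:
  fixes a\<^sub>1 b\<^sub>1 c\<^sub>1 d\<^sub>1 a\<^sub>2 b\<^sub>2 c\<^sub>2 d\<^sub>2 :: real
  assumes "a\<^sub>1 > 0" "b\<^sub>1 > 0" "c\<^sub>1 > 0" "d\<^sub>1 > 0" "a\<^sub>2 > 0" "b\<^sub>2 > 0" "c\<^sub>2 > 0" "d\<^sub>2 > 0"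
  shows "\<exists>!st. st \<in> {0<..} \<times> {0<..} \<and> a\<^sub>1 + b\<^sub>1 * snd st = fst st * (c\<^sub>1 + d\<^sub>1 * snd st) \<and>
     a\<^sub>2 + b\<^sub>2 * fst st = snd st * (c\<^sub>2 + d\<^sub>2 * fst st)"
proof -
  define A where "A = c\<^sub>2 * d\<^sub>1 + d\<^sub>2 * b\<^sub>1"
  define B where "B = c\<^sub>2 * c\<^sub>1 + d\<^sub>2 * a\<^sub>1 - a\<^sub>2 * d\<^sub>1 - b\<^sub>2 * b\<^sub>1"
  define C where "C = a\<^sub>2 * c\<^sub>1 + b\<^sub>2 * a\<^sub>1"
  define f where "f t = (a\<^sub>1 + b\<^sub>1 * t) / (c\<^sub>1 + d\<^sub>1 * t)" for t
  have AC: "A > 0" "C > 0"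
    using assms unfolding A_def C_def by (auto intro: add_pos_pos)
  have eqs: "a\<^sub>1 + b\<^sub>1 * t = s * (c\<^sub>1 + d\<^sub>1 * t) \<and> a\<^sub>2 + b\<^sub>2 * s = t * (c\<^sub>2 + d\<^sub>2 * s) \<longleftrightarrow>
      s = f t \<and> A * t\<^sup>2 + B * t - C = 0" if "t > 0" for s t
  proof -
    have den: "c\<^sub>1 + d\<^sub>1 * t > 0"
      using assms that by (simp add: add_pos_pos)
    then have s: "a\<^sub>1 + b\<^sub>1 * t = s * (c\<^sub>1 + d\<^sub>1 * t) \<longleftrightarrow> s = f t"
      by (auto simp: f_def field_simps)
    have "a\<^sub>2 + b\<^sub>2 * s = t * (c\<^sub>2 + d\<^sub>2 * s) \<longleftrightarrow> A * t\<^sup>2 + B * t - C = 0"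
      if h: "a\<^sub>1 + b\<^sub>1 * t = s * (c\<^sub>1 + d\<^sub>1 * t)"
    proof -
      have "(c\<^sub>1 + d\<^sub>1 * t) * (t * (c\<^sub>2 + d\<^sub>2 * s) - (a\<^sub>2 + b\<^sub>2 * s)) = A * t\<^sup>2 + B * t - C"
        using h unfolding A_def B_def C_def by algebra
      then show ?thesis
        using den by auto
    qed
    with s show ?thesis by blast
  qed
  define r where "r = sqrt (B\<^sup>2 + 4 * A * C)"
  define T where "T = (r - B) / (2 * A)"
  have r: "r\<^sup>2 = B\<^sup>2 + 4 * A * C" "\<bar>B\<bar> < r"
    using AC unfolding r_def by (auto intro: real_less_rsqrt add_pos_pos)
  have T: "T > 0"
    using AC r(2) unfolding T_def by simp
  have root: "A * t\<^sup>2 + B * t - C = 0 \<longleftrightarrow> t = T" if "t > 0" for t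
  proof -
    have "4 * A * (A * t\<^sup>2 + B * t - C) = (2 * A * t + B - r) * (2 * A * t + B + r)"
      using r(1) by algebra
    moreover have "2 * A * t + B + r > 0"
      using r(2) mult_pos_pos[OF AC(1) that] by linarith
    ultimately have "A * t\<^sup>2 + B * t - C = 0 \<longleftrightarrow> 2 * A * t + B - r = 0"
      using AC by auto
    also have "\<dots> \<longleftrightarrow> t = T"
      using AC unfolding T_def by (auto simp: field_simps)
    finally show ?thesis .
  qed
  have "f T > 0"
    using assms T unfolding f_def by (simp add: add_pos_pos)
  then have "st \<in> {0<..} \<times> {0<..} \<and> a\<^sub>1 + b\<^sub>1 * snd st = fst st * (c\<^sub>1 + d\<^sub>1 * snd st) \<and>
     a\<^sub>2 + b\<^sub>2 * fst st = snd st * (c\<^sub>2 + d\<^sub>2 * fst st) \<longleftrightarrow> st = (f T, T)" for st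
    using eqs[of "snd st" "fst st"] root[of "snd st"] T by (cases st) auto
  then show ?thesis by simp
qed

section \<open>Rates of the distances among four points\<close>

text \<open>
The square of a combination with vanishing coefficient sum depends on the distances only, which
makes the relation below insensitive to the choice of a representative up to congruence.
\<close>

lemma four_point_norm_identity:
  fixes a b c d :: "real^2"
  assumes "\<alpha> + \<beta> + \<gamma> + \<delta> = 0"
  shows "(norm (\<alpha> *\<^sub>R a + \<beta> *\<^sub>R b + \<gamma> *\<^sub>R c + \<delta> *\<^sub>R d))\<^sup>2 =
    - (\<alpha>*\<beta> * (dist a b)\<^sup>2 + \<alpha>*\<gamma> * (dist a c)\<^sup>2 + \<alpha>*\<delta> * (dist a d)\<^sup>2 +
       \<beta>*\<gamma> * (dist b c)\<^sup>2 + \<beta>*\<delta> * (dist b d)\<^sup>2 + \<gamma>*\<delta> * (dist c d)\<^sup>2)"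
proof -
  have coordinate: "(\<alpha> * x + \<beta> * y + \<gamma> * z + \<delta> * w)\<^sup>2 =
    - (\<alpha>*\<beta> * (x - y)\<^sup>2 + \<alpha>*\<gamma> * (x - z)\<^sup>2 + \<alpha>*\<delta> * (x - w)\<^sup>2 +
       \<beta>*\<gamma> * (y - z)\<^sup>2 + \<beta>*\<delta> * (y - w)\<^sup>2 + \<gamma>*\<delta> * (z - w)\<^sup>2)" for x y z w
    using assms by algebra
  have "(norm v)\<^sup>2 = (v$1)\<^sup>2 + (v$2)\<^sup>2" for v :: "real^2"
    using dist_plane_sq[of v 0] by simp
  then show ?thesis
    unfolding dist_plane_sq by (simp add: coordinate ring_distribs)
qed

text \<open>
The triangle areas \<open>\<alpha>, \<beta>, \<gamma>, \<delta>\<close> are the coefficients of the affine dependence of \<open>a, b, c, d\<close>. The function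
\<open>r \<mapsto> |\<alpha> A r + \<beta> B r + \<gamma> C r + \<delta> D r|\<^sup>2\<close> is nonnegative and vanishes at \<open>0\<close>, so its derivative vanishes there;
expressed through the distances, this is the claimed relation.
\<close>

lemma path_quadrilateral_rates:
  fixes A B C D :: "real \<Rightarrow> real^2" and a b c d :: "real^2"
  assumes start: "dist (A 0) (B 0) = dist a b" "dist (B 0) (C 0) = dist b c" "dist (C 0) (D 0) = dist c d"
      "dist (A 0) (C 0) = dist a c" "dist (B 0) (D 0) = dist b d" "dist (A 0) (D 0) = dist a d"
    and sides: "((\<lambda>r. (dist (A r) (B r))\<^sup>2) has_real_derivative 0) (at 0)"
      "((\<lambda>r. (dist (B r) (C r))\<^sup>2) has_real_derivative 0) (at 0)"
      "((\<lambda>r. (dist (C r) (D r))\<^sup>2) has_real_derivative 0) (at 0)"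
    and diags: "((\<lambda>r. (dist (A r) (C r))\<^sup>2) has_real_derivative x) (at 0)"
      "((\<lambda>r. (dist (B r) (D r))\<^sup>2) has_real_derivative y) (at 0)"
      "((\<lambda>r. (dist (A r) (D r))\<^sup>2) has_real_derivative z) (at 0)"
  shows "orient b c d * orient a b d * x + orient a c d * orient a b c * y = orient b c d * orient a b c * z"
proof -
  define \<alpha> \<beta> \<gamma> \<delta> where "\<alpha> = orient b c d" and "\<beta> = - orient a c d" and "\<gamma> = orient a b d" and "\<delta> = - orient a b c"
  note abcd = this
  have sum0: "\<alpha> + \<beta> + \<gamma> + \<delta> = 0"
    unfolding abcd orient_def by algebra
  define F where "F r = (norm (\<alpha> *\<^sub>R A r + \<beta> *\<^sub>R B r + \<gamma> *\<^sub>R C r + \<delta> *\<^sub>R D r))\<^sup>2" for r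
  have "\<alpha> *\<^sub>R a + \<beta> *\<^sub>R b + \<gamma> *\<^sub>R c + \<delta> *\<^sub>R d = 0"
    unfolding plane_eq_iff abcd orient_def by (simp, algebra)
  then have "F 0 = 0"
    unfolding F_def four_point_norm_identity[OF sum0] start
    using four_point_norm_identity[OF sum0, of a b c d] by simp
  moreover have "F r \<ge> 0" for r
    by (simp add: F_def)
  moreover have "(F has_real_derivative - (\<alpha>*\<gamma> * x + \<alpha>*\<delta> * z + \<beta>*\<delta> * y)) (at 0)"
    unfolding F_def four_point_norm_identity[OF sum0]
    by (rule derivative_eq_intros sides diags refl | simp)+
  ultimately have "- (\<alpha>*\<gamma> * x + \<alpha>*\<delta> * z + \<beta>*\<delta> * y) = 0"
    by (intro DERIV_local_min[of F _ 0 1]) auto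
  then show ?thesis
    unfolding abcd by algebra
qed

section \<open>Flexing a four-bar linkage\<close>

definition rot :: "real^2 \<Rightarrow> real^2" where
  "rot v = vector [- v$2, v$1]"

lemma rot_nth [simp]: "rot v $ 1 = - v$2" "rot v $ 2 = v$1"
  by (simp_all add: rot_def)

lemma C1_differentiable_onI_real:
  assumes "\<And>r. r \<in> S \<Longrightarrow> (f has_real_derivative f' r) (at r)" "continuous_on S f'"
  shows "f C1_differentiable_on S"
  using assms unfolding C1_differentiable_on_def has_real_derivative_iff_has_vector_derivative by blast

lemma C1_differentiable_on_vec:
  fixes f :: "real \<Rightarrow> 'a::euclidean_space^'n"
  assumes "\<And>i. (\<lambda>r. f r $ i) C1_differentiable_on S"
  shows "f C1_differentiable_on S"
proof -
  have "\<forall>i. \<exists>D. (\<forall>r\<in>S. ((\<lambda>r. f r $ i) has_vector_derivative D r) (at r)) \<and> continuous_on S D"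
    using assms unfolding C1_differentiable_on_def by blast
  then obtain D where D: "\<And>i r. r \<in> S \<Longrightarrow> ((\<lambda>r. f r $ i) has_vector_derivative D i r) (at r)"
      "\<And>i. continuous_on S (D i)"
    by metis
  have ax: "bounded_linear (axis i :: 'a \<Rightarrow> 'a^'n)" for i
    by (intro linear_conv_bounded_linear[THEN iffD1] linearI) (auto simp: axis_def vec_eq_iff)
  have expand: "v = (\<Sum>i\<in>UNIV. axis i (v $ i))" for v :: "'a^'n"
    by (simp add: vec_eq_iff axis_def if_distrib sum.delta cong: if_cong)
  define D' where "D' r = (\<Sum>i\<in>UNIV. axis i (D i r) :: 'a^'n)" for r
  have f: "f = (\<lambda>r. \<Sum>i\<in>UNIV. axis i (f r $ i))"
    by (rule ext, rule expand)
  have "(f has_vector_derivative D' r) (at r)" if "r \<in> S" for r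
    unfolding D'_def by (subst f, intro has_vector_derivative_sum bounded_linear.has_vector_derivative[OF ax] D that)
  moreover have "continuous_on S D'"
    unfolding D'_def by (intro continuous_on_sum bounded_linear.continuous_on[OF ax] D)
  ultimately show ?thesis
    unfolding C1_differentiable_on_def by (intro exI[of _ D']) simp
qed

text \<open>
The bar \<open>ab\<close> is turned about \<open>a\<close>, and the joint \<open>C\<close> is kept at the apex of the isosceles triangle over \<open>B\<close>
and \<open>d\<close> with legs \<open>l\<close>, on the side of its base where \<open>c\<close> lies. The height is a square root that stays
positive for small angles because the triangle \<open>bcd\<close> is not degenerate.
\<close>

lemma four_bar_flex:
  fixes a b c d :: "real^2"
  assumes sides: "dist a b = l" "dist b c = l" "dist c d = l"
    and abd: "orient a b d \<noteq> 0" and bcd: "orient b c d \<noteq> 0"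
  obtains e B C y where "e > 0" "B C1_differentiable_on {-e<..<e}" "C C1_differentiable_on {-e<..<e}"
    "B 0 = b" "C 0 = c" "\<And>r. r \<in> {-e<..<e} \<Longrightarrow> dist a (B r) = l \<and> dist (B r) (C r) = l \<and> dist (C r) d = l"
    "((\<lambda>r. (dist (B r) d)\<^sup>2) has_real_derivative y) (at 0)" "y \<noteq> 0"
proof -
  define u w where "u = b - a" and "w = a - d"
  have l0: "l > 0"
    using sides(1) abd by (cases "a = b") (auto simp: orient_def)
  note sq = sides[THEN arg_cong[where f = power2], unfolded dist_plane_sq]
  (* Q is the squared base of the isosceles triangle, Q' its derivative. *)
  define B where "B r = a + (cos r *\<^sub>R u + sin r *\<^sub>R rot u)" for r
  define Q where "Q r = l\<^sup>2 + (dist a d)\<^sup>2 + 2 * (cos r * (u \<bullet> w) + sin r * (rot u \<bullet> w))" for r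
  define Q' where "Q' r = 2 * (- sin r * (u \<bullet> w) + cos r * (rot u \<bullet> w))" for r
  have sc: "(cos r)\<^sup>2 + (sin r)\<^sup>2 = 1" for r :: real
    by simp
  have aB: "(dist a (B r))\<^sup>2 = l\<^sup>2" for r
    using sc[of r] sq(1) unfolding dist_plane_sq B_def u_def by (simp, algebra)
  have Q: "(dist (B r) d)\<^sup>2 = Q r" for r
    using sc[of r] sq(1) unfolding dist_plane_sq B_def u_def w_def Q_def inner_plane by (simp, algebra)
  have dQ: "(Q has_real_derivative Q' r) (at r)" for r
    unfolding Q_def Q'_def by (auto intro!: derivative_eq_intros)
  have cQ': "continuous_on S Q'" for S
    unfolding Q'_def by (intro continuous_intros)
  have "Q' 0 = - 2 * orient a b d"
    unfolding Q'_def orient_def u_def w_def inner_plane by (simp add: algebra_simps)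
  then have Q'0: "Q' 0 \<noteq> 0"
    using abd by simp
  (* k is the signed ratio of height to base at the start; h below is its modulus along the motion. *)
  define k where "k = orient b d c / Q 0"
  have B0: "B 0 = b"
    by (simp add: B_def u_def)
  have Q0: "Q 0 = (d$1 - b$1)\<^sup>2 + (d$2 - b$2)\<^sup>2"
    using Q[of 0] unfolding B0 dist_plane_sq by (simp add: power2_commute)
  have "b \<noteq> d"
    using abd by (auto simp: orient_def)
  then have Q0pos: "Q 0 > 0"
    unfolding Q0 by (auto simp: plane_eq_iff sum_power2_gt_zero_iff)
  have kQ: "k * Q 0 = orient b d c"
    using Q0pos by (simp add: k_def)
  have k0: "k \<noteq> 0"
    using bcd Q0pos by (auto simp: k_def orient_def algebra_simps)
  have iso: "2 * ((c$1 - b$1) * (d$1 - b$1) + (c$2 - b$2) * (d$2 - b$2)) = Q 0"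
    using sq(2,3) unfolding Q0 by algebra
  have decomp: "Q 0 * (c$1 - b$1) = (d$1 - b$1) * ((c$1 - b$1) * (d$1 - b$1) + (c$2 - b$2) * (d$2 - b$2)) - (d$2 - b$2) * orient b d c"
    "Q 0 * (c$2 - b$2) = (d$2 - b$2) * ((c$1 - b$1) * (d$1 - b$1) + (c$2 - b$2) * (d$2 - b$2)) + (d$1 - b$1) * orient b d c"
    unfolding Q0 orient_def by algebra+
  have half: "(c$1 - b$1) * (d$1 - b$1) + (c$2 - b$2) * (d$2 - b$2) = Q 0 / 2"
    using iso by simp
  have "Q 0 * (c$1 - b$1) = Q 0 * ((d$1 - b$1) / 2 - k * (d$2 - b$2))"
    "Q 0 * (c$2 - b$2) = Q 0 * ((d$2 - b$2) / 2 + k * (d$1 - b$1))"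
    unfolding decomp half kQ[symmetric] by (simp_all add: field_simps)
  then have "c$1 - b$1 = (d$1 - b$1) / 2 - k * (d$2 - b$2)" "c$2 - b$2 = (d$2 - b$2) / 2 + k * (d$1 - b$1)"
    using Q0pos by (metis mult_cancel_left order_less_irrefl)+
  then have c12: "c$1 = (b$1 + d$1) / 2 - k * (d$2 - b$2)" "c$2 = (b$2 + d$2) / 2 + k * (d$1 - b$1)"
    by argo+
  have k2: "l\<^sup>2 = (k\<^sup>2 + 1/4) * Q 0"
    using sq(2) unfolding c12 Q0 by (simp add: field_simps power2_eq_square)
  have "Q 0 < 4 * l\<^sup>2"
    using k0 Q0pos unfolding k2 by (simp add: field_simps)
  moreover have "isCont Q 0"
    using dQ DERIV_isCont by blast
  ultimately have "eventually (\<lambda>r. 0 < Q r \<and> Q r < 4 * l\<^sup>2) (nhds 0)"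
    using Q0pos order_tendstoD[of Q "Q 0" "nhds 0"] unfolding isCont_def tendsto_at_iff_tendsto_nhds by (auto intro: eventually_conj)
  then obtain e where e: "e > 0" "\<And>r. r \<in> {-e<..<e} \<Longrightarrow> 0 < Q r \<and> Q r < 4 * l\<^sup>2"
    unfolding eventually_nhds_metric by (force simp: dist_real_def abs_less_iff)
  define h where "h r = sqrt (l\<^sup>2 / Q r - 1/4)" for r
  have hpos: "l\<^sup>2 / Q r - 1/4 > 0" if "r \<in> {-e<..<e}" for r
    using e(2)[OF that] by (simp add: field_simps)
  define h' where "h' r = (- (l\<^sup>2 * Q' r) / (Q r)\<^sup>2) * (inverse (sqrt (l\<^sup>2 / Q r - 1/4)) / 2)" for r
  have dh: "(h has_real_derivative h' r) (at r)" if "r \<in> {-e<..<e}" for r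
  proof -
    have "((\<lambda>r. l\<^sup>2 / Q r - 1/4) has_real_derivative (- (l\<^sup>2 * Q' r) / (Q r)\<^sup>2)) (at r)"
      using e(2)[OF that] by (auto intro!: derivative_eq_intros dQ simp: power2_eq_square)
    from DERIV_chain2[OF DERIV_real_sqrt[OF hpos[OF that]] this] show ?thesis
      unfolding h_def h'_def by (simp only: mult.commute)
  qed
  have cQ: "continuous_on S Q" for S
    unfolding Q_def by (intro continuous_intros)
  have "Q r \<noteq> 0" "sqrt (l\<^sup>2 / Q r - 1/4) \<noteq> 0" if "r \<in> {-e<..<e}" for r
    using e(2)[OF that] hpos[OF that] by auto
  then have "continuous_on {-e<..<e} h'"
    unfolding h'_def by (intro continuous_intros cQ cQ') auto
  then have h: "h C1_differentiable_on {-e<..<e}"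
    using dh by (rule C1_differentiable_onI_real[rotated])
  have trig: "cos C1_differentiable_on S" "sin C1_differentiable_on S" for S :: "real set"
    by (rule C1_differentiable_onI_real, rule DERIV_cos DERIV_sin, intro continuous_intros)+
  define C where "C r = (1/2) *\<^sub>R (B r + d) + (sgn k * h r) *\<^sub>R (rot (d - a) - (cos r *\<^sub>R rot u - sin r *\<^sub>R u))" for r
  have C12: "C r $ 1 = (B r $ 1 + d$1) / 2 - (sgn k * h r) * (d$2 - B r $ 2)"
    "C r $ 2 = (B r $ 2 + d$2) / 2 + (sgn k * h r) * (d$1 - B r $ 1)" for r
    unfolding C_def B_def by (simp_all add: field_simps)
  have CB: "(dist (B r) (C r))\<^sup>2 = l\<^sup>2" "(dist (C r) d)\<^sup>2 = l\<^sup>2" if "r \<in> {-e<..<e}" for r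
  proof -
    have "(sgn k * h r)\<^sup>2 = l\<^sup>2 / Q r - 1/4"
      using hpos[OF that] k0 by (simp add: h_def power_mult_distrib sgn_real_def)
    then have "((sgn k * h r)\<^sup>2 + 1/4) * Q r = l\<^sup>2"
      using e(2)[OF that] by (simp add: field_simps)
    moreover have "(dist (B r) (C r))\<^sup>2 = ((sgn k * h r)\<^sup>2 + 1/4) * Q r" "(dist (C r) d)\<^sup>2 = ((sgn k * h r)\<^sup>2 + 1/4) * Q r"
      unfolding Q[symmetric] dist_plane_sq C12 by (simp_all add: field_simps power2_eq_square)
    ultimately show "(dist (B r) (C r))\<^sup>2 = l\<^sup>2" "(dist (C r) d)\<^sup>2 = l\<^sup>2"
      by simp_all
  qed
  have "h 0 = \<bar>k\<bar>"
    using Q0pos unfolding h_def k2 by simp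
  then have "sgn k * h 0 = k"
    by (simp add: sgn_mult_abs)
  then have C0: "C 0 = c"
    unfolding plane_eq_iff C12 B0 c12 by simp
  have C1B: "B C1_differentiable_on {-e<..<e}"
    unfolding B_def by (intro C1_differentiable_on_add C1_differentiable_on_scaleR C1_differentiable_on_const trig)
  have C1C: "C C1_differentiable_on {-e<..<e}"
    unfolding C_def
    by (intro C1_differentiable_on_add C1_differentiable_on_diff C1_differentiable_on_scaleR C1_differentiable_on_mult trig h C1B C1_differentiable_on_const)
  show ?thesis
  proof (rule that[OF e(1) C1B C1C B0 C0])
    show "dist a (B r) = l \<and> dist (B r) (C r) = l \<and> dist (C r) d = l" if "r \<in> {-e<..<e}" for r
      using aB[of r] CB[OF that] l0 by (auto intro: power2_eq_imp_eq)
    show "((\<lambda>r. (dist (B r) d)\<^sup>2) has_real_derivative Q' 0) (at 0)"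
      unfolding Q by (rule dQ)
  qed (rule Q'0)
qed

section \<open>Motions of the pentagon and rates of its diagonals\<close>

text \<open>
The curve may start at any configuration congruent to \<open>p\<close>, as in the definition of critical points.
\<close>

definition motion :: "real \<Rightarrow> configuration \<Rightarrow> (real \<Rightarrow> configuration) \<Rightarrow> real \<Rightarrow> bool" where
  "motion l p \<gamma> e \<longleftrightarrow> e > 0 \<and> \<gamma> C1_differentiable_on {-e<..<e} \<and> \<gamma> ` {-e<..<e} \<subseteq> config_space l \<and>
     config_class l (\<gamma> 0) = config_class l p"

lemma critical_point_iff_motion:
  assumes "p \<in> config_space l"
  shows "critical_point l f (config_class l p) \<longleftrightarrow>
    (\<forall>\<gamma> e. motion l p \<gamma> e \<longrightarrow> ((\<lambda>r. f (config_class l (\<gamma> r))) has_real_derivative 0) (at 0))"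
proof -
  have "config_class l p \<in> moduli_space l"
    unfolding config_class_def moduli_space_def using assms by (rule quotientI)
  then show ?thesis
    unfolding critical_point_def motion_def by simp
qed

text \<open>
Squared distances are used because they are polynomial in the coordinates.
\<close>

definition rate :: "(real \<Rightarrow> configuration) \<Rightarrow> 5 \<Rightarrow> 5 \<Rightarrow> real" where
  "rate \<gamma> i j = deriv (\<lambda>r. (dist (\<gamma> r $ i) (\<gamma> r $ j))\<^sup>2) 0"

lemma motion_start_dist:
  assumes "motion l p \<gamma> e" "p \<in> config_space l"
  shows "dist (\<gamma> 0 $ i) (\<gamma> 0 $ j) = dist (p $ i) (p $ j)"
proof -
  have "\<gamma> 0 \<in> config_space l"
    using assms(1) unfolding motion_def by auto
  then have "dist (\<gamma> 0 $ i) (\<gamma> 0 $ j) = diagonal i j (config_class l (\<gamma> 0))"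
    by (rule diagonal_config_class[symmetric])
  also have "\<dots> = diagonal i j (config_class l p)"
    using assms(1) by (simp add: motion_def)
  also have "\<dots> = dist (p $ i) (p $ j)"
    using assms(2) by (rule diagonal_config_class)
  finally show ?thesis .
qed

lemma squared_dist_has_rate:
  assumes "motion l p \<gamma> e"
  shows "((\<lambda>r. (dist (\<gamma> r $ i) (\<gamma> r $ j))\<^sup>2) has_real_derivative rate \<gamma> i j) (at 0)"
proof -
  have "0 \<in> {-e<..<e}" and "\<gamma> C1_differentiable_on {-e<..<e}"
    using assms unfolding motion_def by auto
  then obtain v where v: "(\<gamma> has_vector_derivative v) (at 0)"
    unfolding C1_differentiable_on_def by blast
  have nth: "((\<lambda>r. \<gamma> r $ k $ m) has_real_derivative v $ k $ m) (at 0)" for k m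
    unfolding has_real_derivative_iff_has_vector_derivative
    by (intro bounded_linear.has_vector_derivative[OF bounded_linear_vec_nth] v)
  have "\<exists>D. ((\<lambda>r. (dist (\<gamma> r $ i) (\<gamma> r $ j))\<^sup>2) has_real_derivative D) (at 0)"
    unfolding dist_plane_sq by (rule exI) (rule derivative_eq_intros nth refl)+
  then show ?thesis
    unfolding rate_def DERIV_deriv_iff_real_differentiable real_differentiable_def .
qed

lemma rate_side:
  assumes "motion l p \<gamma> e"
  shows "rate \<gamma> i (i + 1) = 0"
proof -
  have "((\<lambda>r. (dist (\<gamma> r $ i) (\<gamma> r $ (i + 1)))\<^sup>2) has_real_derivative 0) (at 0)"
  proof (rule has_field_derivative_transform_within_open[of "\<lambda>r. l\<^sup>2" _ _ "{-e<..<e}"])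
    show "l\<^sup>2 = (dist (\<gamma> r $ i) (\<gamma> r $ (i + 1)))\<^sup>2" if "r \<in> {-e<..<e}" for r
      using assms that unfolding motion_def config_space_def by (auto simp: image_subset_iff)
  qed (use assms in \<open>auto simp: motion_def\<close>)
  then show ?thesis
    unfolding rate_def by (rule DERIV_imp_deriv)
qed

text \<open>
Any four of the five vertices form a path of three sides, so that three of their six rates vanish.
\<close>

lemma path_rates:
  assumes m: "motion l p \<gamma> e" and p: "p \<in> config_space l"
    and "rate \<gamma> i j = 0" "rate \<gamma> j k = 0" "rate \<gamma> k m = 0"
  shows "orient (p$j) (p$k) (p$m) * orient (p$i) (p$j) (p$m) * rate \<gamma> i k +
     orient (p$i) (p$k) (p$m) * orient (p$i) (p$j) (p$k) * rate \<gamma> j m =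
     orient (p$j) (p$k) (p$m) * orient (p$i) (p$j) (p$k) * rate \<gamma> i m"
proof -
  note rt = squared_dist_has_rate[OF m]
  show ?thesis
    using rt[of i j] rt[of j k] rt[of k m] rt[of i k] rt[of j m] rt[of i m]
    unfolding assms(3-5) by (intro path_quadrilateral_rates[where A = "\<lambda>r. \<gamma> r $ i" and B = "\<lambda>r. \<gamma> r $ j" and C = "\<lambda>r. \<gamma> r $ k"
      and D = "\<lambda>r. \<gamma> r $ m"] motion_start_dist[OF m p])
qed

text \<open>
With \<open>h, h + 3, h + 4\<close> at rest, the quadrilateral \<open>h, h + 1, h + 2, h + 3\<close> flexes as a four-bar linkage.
\<close>

lemma motion_flexing_quadrilateral:
  assumes p: "p \<in> config_space l"
    and orients: "orient (p $ h) (p $ (h + 1)) (p $ (h + 3)) \<noteq> 0" "orient (p $ (h + 1)) (p $ (h + 2)) (p $ (h + 3)) \<noteq> 0"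
  obtains \<gamma> e where "motion l p \<gamma> e" "rate \<gamma> h (h + 3) = 0" "rate \<gamma> (h + 1) (h + 3) \<noteq> 0"
proof -
  have sides: "dist (p $ i) (p $ (i + 1)) = l" for i
    using p unfolding config_space_def by blast
  have bars: "dist (p $ h) (p $ (h + 1)) = l" "dist (p $ (h + 1)) (p $ (h + 2)) = l" "dist (p $ (h + 2)) (p $ (h + 3)) = l"
    using sides[of h] sides[of "h + 1"] sides[of "h + 2"] by (simp_all add: add.assoc)
  obtain e B C y where e: "e > 0" and C1: "B C1_differentiable_on {-e<..<e}" "C C1_differentiable_on {-e<..<e}"
    and start: "B 0 = p $ (h + 1)" "C 0 = p $ (h + 2)"
    and len: "\<And>r. r \<in> {-e<..<e} \<Longrightarrow> dist (p $ h) (B r) = l \<and> dist (B r) (C r) = l \<and> dist (C r) (p $ (h + 3)) = l"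
    and y: "((\<lambda>r. (dist (B r) (p $ (h + 3)))\<^sup>2) has_real_derivative y) (at 0)" "y \<noteq> 0"
    by (rule four_bar_flex[OF bars orients], rule that)
  define \<gamma> :: "real \<Rightarrow> configuration"
    where "\<gamma> r = (\<chi> i. if i = h + 1 then B r else if i = h + 2 then C r else p $ i)" for r
  have nth: "\<gamma> r $ h = p $ h" "\<gamma> r $ (h + 1) = B r" "\<gamma> r $ (h + 2) = C r" "\<gamma> r $ (h + 3) = p $ (h + 3)" for r
    by (simp_all add: \<gamma>_def)
  have fixed: "\<gamma> r $ i = p $ i" if "i \<noteq> h + 1" "i \<noteq> h + 2" for i r
    using that by (simp add: \<gamma>_def)
  have "\<gamma> 0 = p"
    by (simp add: \<gamma>_def start vec_eq_iff)
  moreover have "(\<lambda>r. \<gamma> r $ i) C1_differentiable_on {-e<..<e}" for i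
    using C1 by (cases "i = h + 1"; cases "i = h + 2") (auto simp: \<gamma>_def)
  then have "\<gamma> C1_differentiable_on {-e<..<e}"
    by (rule C1_differentiable_on_vec)
  moreover have "dist (\<gamma> r $ i) (\<gamma> r $ (i + 1)) = l" if "r \<in> {-e<..<e}" for r i
  proof -
    consider "i = h" | "i = h + 1" | "i = h + 2" | "i \<noteq> h" "i \<noteq> h + 1" "i \<noteq> h + 2"
      by blast
    then show ?thesis
    proof cases
      case 4
      then have "\<gamma> r $ i = p $ i" "\<gamma> r $ (i + 1) = p $ (i + 1)"
        using fixed[of i] fixed[of "i + 1"] by (auto simp: algebra_simps)
      then show ?thesis
        using sides by simp
    qed (use len[OF that] nth[of r] in \<open>simp_all add: add.assoc\<close>)
  qed
  ultimately have "motion l p \<gamma> e"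
    unfolding motion_def config_space_def using e by auto
  moreover have "rate \<gamma> h (h + 3) = 0" "rate \<gamma> (h + 1) (h + 3) = y"
    unfolding rate_def nth using y(1) by (auto intro: DERIV_imp_deriv)
  ultimately show ?thesis
    using that y(2) by blast
qed

lemma rate_commute: "rate \<gamma> j i = rate \<gamma> i j"
  by (simp add: rate_def dist_commute)

text \<open>
The relations for the vertex sets that omit 5, 3, 2 and 1. Scaling each triangle area by \<open>\<epsilon>\<close> makes
all coefficients positive for a convexly ordered pentagon.
\<close>

lemma diagonal_rate_relations:
  fixes \<epsilon> :: real
  assumes m: "motion l p \<gamma> e" and p: "p \<in> config_space l"
  defines "T \<equiv> \<lambda>i j k. \<epsilon> * orient (p $ i) (p $ j) (p $ k)"
  shows "T 2 3 4 * T 1 2 4 * rate \<gamma> 1 3 + T 1 3 4 * T 1 2 3 * rate \<gamma> 2 4 = T 2 3 4 * T 1 2 3 * rate \<gamma> 1 4"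
    and "T 1 2 5 * T 2 4 5 * rate \<gamma> 1 4 + T 1 2 4 * T 1 4 5 * rate \<gamma> 2 5 = T 1 2 5 * T 1 4 5 * rate \<gamma> 2 4"
    and "T 1 4 5 * T 1 3 4 * rate \<gamma> 3 5 + T 1 3 5 * T 3 4 5 * rate \<gamma> 1 4 = T 1 4 5 * T 3 4 5 * rate \<gamma> 1 3"
    and "T 3 4 5 * T 2 3 5 * rate \<gamma> 2 4 + T 2 4 5 * T 2 3 4 * rate \<gamma> 3 5 = T 3 4 5 * T 2 3 4 * rate \<gamma> 2 5"
proof -
  have z: "rate \<gamma> 1 2 = 0" "rate \<gamma> 2 3 = 0" "rate \<gamma> 3 4 = 0" "rate \<gamma> 4 5 = 0" "rate \<gamma> 5 1 = 0"
    using rate_side[OF m, of 1] rate_side[OF m, of 2] rate_side[OF m, of 3] rate_side[OF m, of 4]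
      rate_side[OF m, of 5] unfolding succ_5 by auto
  note rel = path_rates[OF m p, THEN arg_cong[where f = "\<lambda>x. \<epsilon>\<^sup>2 * x"]]
  note rot = orient_rotate[of "p$4" "p$5" "p$1"] orient_rotate[of "p$3" "p$5" "p$1"] orient_rotate[of "p$3" "p$4" "p$1"]
    orient_rotate[of "p$4" "p$5" "p$2"] orient_rotate[of "p$1" "p$2" "p$5", symmetric] orient_rotate[of "p$1" "p$2" "p$4", symmetric]
  have comm: "rate \<gamma> 4 1 = rate \<gamma> 1 4" "rate \<gamma> 5 2 = rate \<gamma> 2 5" "rate \<gamma> 4 2 = rate \<gamma> 2 4" "rate \<gamma> 3 1 = rate \<gamma> 1 3"
    by (rule rate_commute)+
  show "T 2 3 4 * T 1 2 4 * rate \<gamma> 1 3 + T 1 3 4 * T 1 2 3 * rate \<gamma> 2 4 = T 2 3 4 * T 1 2 3 * rate \<gamma> 1 4"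
    "T 1 2 5 * T 2 4 5 * rate \<gamma> 1 4 + T 1 2 4 * T 1 4 5 * rate \<gamma> 2 5 = T 1 2 5 * T 1 4 5 * rate \<gamma> 2 4"
    "T 1 4 5 * T 1 3 4 * rate \<gamma> 3 5 + T 1 3 5 * T 3 4 5 * rate \<gamma> 1 4 = T 1 4 5 * T 3 4 5 * rate \<gamma> 1 3"
    "T 3 4 5 * T 2 3 5 * rate \<gamma> 2 4 + T 2 4 5 * T 2 3 4 * rate \<gamma> 3 5 = T 3 4 5 * T 2 3 4 * rate \<gamma> 2 5"
    using rel[OF z(1,2,3)] rel[OF z(4,5,1)] rel[OF z(3,4,5)] rel[OF z(2,3,4)]
    unfolding T_def rot comm by (simp_all add: power2_eq_square algebra_simps)
qed

text \<open>
The four-point relations express \<open>D\<^sub>3\<^sub>5\<close> in two ways; each shows the sign of one coefficient only.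
Comparing them on a motion with \<open>D\<^sub>2\<^sub>4 = 0 \<noteq> D\<^sub>1\<^sub>4\<close> carries the sign of the \<open>D\<^sub>1\<^sub>4\<close> coefficient over from the
second expression to the first.
\<close>

lemma diagonal_rates:
  assumes p: "p \<in> config_space l" and ord: "convexly_ordered \<epsilon> (p$1) (p$2) (p$3) (p$4) (p$5)"
  obtains a b c d f g where "a > 0" "b > 0" "c > 0" "d > 0" "f > 0" "g > 0"
    "\<And>\<gamma> e. motion l p \<gamma> e \<Longrightarrow> rate \<gamma> 1 3 = a * rate \<gamma> 1 4 - b * rate \<gamma> 2 4"
    "\<And>\<gamma> e. motion l p \<gamma> e \<Longrightarrow> rate \<gamma> 2 5 = c * rate \<gamma> 2 4 - d * rate \<gamma> 1 4"
    "\<And>\<gamma> e. motion l p \<gamma> e \<Longrightarrow> rate \<gamma> 3 5 = - f * rate \<gamma> 1 4 - g * rate \<gamma> 2 4"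
    "\<exists>\<gamma> e. motion l p \<gamma> e \<and> rate \<gamma> 1 4 \<noteq> 0 \<and> rate \<gamma> 2 4 = 0"
    "\<exists>\<gamma> e. motion l p \<gamma> e \<and> rate \<gamma> 1 4 = 0 \<and> rate \<gamma> 2 4 \<noteq> 0"
proof -
  define T where "T i j k = \<epsilon> * orient (p $ i) (p $ j) (p $ k)" for i j k
  have T: "T 1 2 3 > 0" "T 1 2 4 > 0" "T 1 2 5 > 0" "T 1 3 4 > 0" "T 1 3 5 > 0" "T 1 4 5 > 0"
    "T 2 3 4 > 0" "T 2 3 5 > 0" "T 2 4 5 > 0" "T 3 4 5 > 0"
    using ord unfolding convexly_ordered_def T_def by auto
  note rel = diagonal_rate_relations[of l p _ _ \<epsilon>, folded T_def, OF _ p]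
  define a b c d where "a = T 1 2 3 / T 1 2 4" and "b = T 1 3 4 * T 1 2 3 / (T 2 3 4 * T 1 2 4)"
    and "c = T 1 2 5 / T 1 2 4" and "d = T 1 2 5 * T 2 4 5 / (T 1 2 4 * T 1 4 5)"
  have r13: "rate \<gamma> 1 3 = a * rate \<gamma> 1 4 - b * rate \<gamma> 2 4" if "motion l p \<gamma> e" for \<gamma> e
    using rel(1)[OF that] T unfolding a_def b_def by (simp add: field_simps)
  have r25: "rate \<gamma> 2 5 = c * rate \<gamma> 2 4 - d * rate \<gamma> 1 4" if "motion l p \<gamma> e" for \<gamma> e
    using rel(2)[OF that] T unfolding c_def d_def by (simp add: field_simps)
  define q where "q = T 1 3 5 * T 3 4 5 / (T 1 4 5 * T 1 3 4)"
  define v where "v = T 3 4 5 * T 2 3 5 / (T 2 4 5 * T 2 3 4)"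
  define u w where "u = T 3 4 5 / T 1 3 4" and "w = T 3 4 5 / T 2 4 5"
  have r35: "rate \<gamma> 3 5 = u * rate \<gamma> 1 3 - q * rate \<gamma> 1 4" "rate \<gamma> 3 5 = w * rate \<gamma> 2 5 - v * rate \<gamma> 2 4"
    if "motion l p \<gamma> e" for \<gamma> e
    using rel(3,4)[OF that] T unfolding q_def u_def v_def w_def by (simp_all add: field_simps)
  have pos: "a > 0" "b > 0" "c > 0" "d > 0" "w * d > 0" "u * b > 0"
    using T unfolding a_def b_def c_def d_def u_def w_def by simp_all
  have nz: "orient (p $ 1) (p $ 2) (p $ 4) \<noteq> 0" "orient (p $ 2) (p $ 3) (p $ 4) \<noteq> 0"
     "orient (p $ 4) (p $ 5) (p $ 2) \<noteq> 0" "orient (p $ 5) (p $ 1) (p $ 2) \<noteq> 0"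
    using T orient_rotate[of "p$4" "p$5" "p$2"] orient_rotate[of "p$1" "p$2" "p$5"] unfolding T_def by auto
  obtain \<gamma>\<^sub>1 e\<^sub>1 where m1: "motion l p \<gamma>\<^sub>1 e\<^sub>1" "rate \<gamma>\<^sub>1 1 4 = 0" "rate \<gamma>\<^sub>1 2 4 \<noteq> 0"
    using motion_flexing_quadrilateral[OF p, of 1] nz by auto
  (* The flex of 4, 5, 1, 2 keeps the distance from 4 to 2 and changes the one from 5 to 2,
     hence also the one from 1 to 4. *)
  have wrap: "(4::5) + 1 = 5" "(4::5) + 2 = 1" "(4::5) + 3 = 2"
    by simp_all
  obtain \<gamma>\<^sub>2 e\<^sub>2 where m2: "motion l p \<gamma>\<^sub>2 e\<^sub>2" "rate \<gamma>\<^sub>2 4 2 = 0" "rate \<gamma>\<^sub>2 5 2 \<noteq> 0"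
    using motion_flexing_quadrilateral[OF p, of 4, unfolded wrap] nz by blast
  have m2': "rate \<gamma>\<^sub>2 2 4 = 0" "rate \<gamma>\<^sub>2 1 4 \<noteq> 0"
    using m2(2,3) r25[OF m2(1)] rate_commute[of \<gamma>\<^sub>2 4 2] rate_commute[of \<gamma>\<^sub>2 5 2] by auto
  have "(u * a - q) * rate \<gamma>\<^sub>2 1 4 = - (w * d) * rate \<gamma>\<^sub>2 1 4"
    using r35[OF m2(1)] r13[OF m2(1)] r25[OF m2(1)] m2'(1) by (simp add: algebra_simps)
  then have coeff: "u * a - q = - (w * d)"
    using m2'(2) mult_right_cancel by blast
  have r35': "rate \<gamma> 3 5 = - (w * d) * rate \<gamma> 1 4 - (u * b) * rate \<gamma> 2 4" if "motion l p \<gamma> e" for \<gamma> e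
    unfolding coeff[symmetric] r35(1)[OF that] r13[OF that] by (simp add: algebra_simps)
  show ?thesis
  proof (rule that[OF pos])
    show "\<exists>\<gamma> e. motion l p \<gamma> e \<and> rate \<gamma> 1 4 \<noteq> 0 \<and> rate \<gamma> 2 4 = 0"
      using m2(1) m2' by blast
    show "\<exists>\<gamma> e. motion l p \<gamma> e \<and> rate \<gamma> 1 4 = 0 \<and> rate \<gamma> 2 4 \<noteq> 0"
      using m1 by blast
  qed (fact r13 r25 r35')+
qed

section \<open>Critical points of the Coulomb potential\<close>

lemma inverse_dist_has_derivative:
  fixes A B :: "real \<Rightarrow> real^2"
  assumes "((\<lambda>r. (dist (A r) (B r))\<^sup>2) has_real_derivative D) (at 0)" "dist (A 0) (B 0) = x" "x > 0"
  shows "((\<lambda>r. 1 / dist (A r) (B r)) has_real_derivative - (D / (2 * x ^ 3))) (at 0)"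
proof -
  have "((\<lambda>r. sqrt ((dist (A r) (B r))\<^sup>2)) has_real_derivative inverse (sqrt (x\<^sup>2)) / 2 * D) (at 0)"
    using DERIV_chain2[OF DERIV_real_sqrt assms(1)] assms(2,3) by simp
  then have "((\<lambda>r. dist (A r) (B r)) has_real_derivative inverse x / 2 * D) (at 0)"
    using assms(3) by simp
  from DERIV_inverse_fun[OF this] show ?thesis
    using assms(2,3) by (simp add: inverse_eq_divide power3_eq_cube power2_eq_square field_simps)
qed

lemma coulomb_has_derivative:
  assumes m: "motion l p \<gamma> e" and p: "p \<in> config_space l"
    and x: "\<And>i j. x i j = dist (p $ i) (p $ j)" and pos: "x 1 4 > 0" "x 2 4 > 0" "x 1 3 > 0" "x 2 5 > 0" "x 3 5 > 0"
  shows "((\<lambda>r. coulomb s t (config_class l (\<gamma> r))) has_real_derivative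
    - (rate \<gamma> 1 4 / x 1 4 ^ 3 + rate \<gamma> 2 4 / x 2 4 ^ 3 + t * (rate \<gamma> 1 3 / x 1 3 ^ 3) +
       s * (rate \<gamma> 2 5 / x 2 5 ^ 3) + s * t * (rate \<gamma> 3 5 / x 3 5 ^ 3)) / 2) (at 0)"
proof (rule has_field_derivative_transform_within_open)
  let ?d = "\<lambda>i j r. 1 / dist (\<gamma> r $ i) (\<gamma> r $ j)"
  have d: "(?d i j has_real_derivative - (rate \<gamma> i j / (2 * x i j ^ 3))) (at 0)" if "x i j > 0" for i j
    using that unfolding x
    by (intro inverse_dist_has_derivative squared_dist_has_rate[OF m] motion_start_dist[OF m p])
  show "((\<lambda>r. ?d 1 4 r + ?d 2 4 r + t * ?d 1 3 r + s * ?d 2 5 r + s * t * ?d 3 5 r) has_real_derivative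
    - (rate \<gamma> 1 4 / x 1 4 ^ 3 + rate \<gamma> 2 4 / x 2 4 ^ 3 + t * (rate \<gamma> 1 3 / x 1 3 ^ 3) +
       s * (rate \<gamma> 2 5 / x 2 5 ^ 3) + s * t * (rate \<gamma> 3 5 / x 3 5 ^ 3)) / 2) (at 0)"
    using DERIV_add[OF DERIV_add[OF DERIV_add[OF DERIV_add[OF d[OF pos(1)] d[OF pos(2)]]
      DERIV_cmult[OF d[OF pos(3)], of t]] DERIV_cmult[OF d[OF pos(4)], of s]] DERIV_cmult[OF d[OF pos(5)], of "s * t"]]
    by (rule DERIV_cong) (simp add: add_divide_distrib)
  show "open {-e<..<e}" "0 \<in> {-e<..<e}"
    using m by (auto simp: motion_def)
  show "?d 1 4 r + ?d 2 4 r + t * ?d 1 3 r + s * ?d 2 5 r + s * t * ?d 3 5 r = coulomb s t (config_class l (\<gamma> r))"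
    if "r \<in> {-e<..<e}" for r
    using m that unfolding motion_def coulomb_def by (simp add: image_subset_iff diagonal_config_class)
qed

theorem theorem2:
  fixes l :: real and P :: "configuration set"
  assumes "l > 0"
    and "P \<in> moduli_space l"
    and "strictly_convex P"
  shows "\<exists>!st. st \<in> {0<..} \<times> {0<..} \<and> critical_point l (coulomb (fst st) (snd st)) P"
proof -
  obtain p where "p \<in> P" and conv: "convex_pentagon p" "\<forall>i. vertex_angle p i < pi"
    using assms(3) unfolding strictly_convex_def by blast
  obtain q where q: "q \<in> config_space l" "P = congruent_rel l `` {q}"
    using assms(2) unfolding moduli_space_def by (rule quotientE)
  then have qp: "(q, p) \<in> congruent_rel l"
    using \<open>p \<in> P\<close> by simp
  then have p: "p \<in> config_space l"
    unfolding congruent_rel_def by blast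
  have P: "P = config_class l p"
    unfolding q(2) config_class_def using equiv_congruent_rel qp by (rule equiv_class_eq)
  obtain \<epsilon> where ord: "convexly_ordered \<epsilon> (p$1) (p$2) (p$3) (p$4) (p$5)"
    using strictly_convex_vertices_ordered[OF assms(1) p conv] by blast
  obtain a b c d f g where pos: "a > 0" "b > 0" "c > 0" "d > 0" "f > 0" "g > 0"
    and rates: "\<And>\<gamma> e. motion l p \<gamma> e \<Longrightarrow> rate \<gamma> 1 3 = a * rate \<gamma> 1 4 - b * rate \<gamma> 2 4"
      "\<And>\<gamma> e. motion l p \<gamma> e \<Longrightarrow> rate \<gamma> 2 5 = c * rate \<gamma> 2 4 - d * rate \<gamma> 1 4"
      "\<And>\<gamma> e. motion l p \<gamma> e \<Longrightarrow> rate \<gamma> 3 5 = - f * rate \<gamma> 1 4 - g * rate \<gamma> 2 4"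
    and m14: "\<exists>\<gamma> e. motion l p \<gamma> e \<and> rate \<gamma> 1 4 \<noteq> 0 \<and> rate \<gamma> 2 4 = 0"
    and m24: "\<exists>\<gamma> e. motion l p \<gamma> e \<and> rate \<gamma> 1 4 = 0 \<and> rate \<gamma> 2 4 \<noteq> 0"
    by (rule diagonal_rates[OF p ord], rule that)
  define x where "x i j = dist (p $ i) (p $ j)" for i j
  have x: "x 1 4 > 0" "x 2 4 > 0" "x 1 3 > 0" "x 2 5 > 0" "x 3 5 > 0"
    using ord unfolding convexly_ordered_def orient_def x_def by auto
  define y where "y i j = 1 / x i j ^ 3" for i j
  have y: "y 1 4 > 0" "y 2 4 > 0" "y 1 3 > 0" "y 2 5 > 0" "y 3 5 > 0"
    using x unfolding y_def by simp_all
  (* Up to the factor -1/2, K and L are the coefficients of the rates of the diagonals 14 and 24. *)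
  define K where "K s t = y 1 4 + (a * y 1 3) * t - s * (d * y 2 5 + (f * y 3 5) * t)" for s t
  define L where "L s t = y 2 4 + (c * y 2 5) * s - t * (b * y 1 3 + (g * y 3 5) * s)" for s t
  have deriv: "((\<lambda>r. coulomb s t (config_class l (\<gamma> r))) has_real_derivative
      - (K s t * rate \<gamma> 1 4 + L s t * rate \<gamma> 2 4) / 2) (at 0)" if m: "motion l p \<gamma> e" for \<gamma> e s t
    using coulomb_has_derivative[OF m p x_def x, of s t] unfolding rates[OF m] K_def L_def y_def
    by (simp add: algebra_simps diff_divide_distrib add_divide_distrib)
  have crit: "critical_point l (coulomb s t) P \<longleftrightarrow> K s t = 0 \<and> L s t = 0" for s t
  proof
    assume "critical_point l (coulomb s t) P"
    then have zero: "K s t * rate \<gamma> 1 4 + L s t * rate \<gamma> 2 4 = 0" if "motion l p \<gamma> e" for \<gamma> e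
      using DERIV_unique[OF deriv[OF that]] that unfolding P critical_point_iff_motion[OF p] by force
    show "K s t = 0 \<and> L s t = 0"
      using m14 m24 zero by fastforce
  next
    assume "K s t = 0 \<and> L s t = 0"
    then show "critical_point l (coulomb s t) P"
      unfolding P critical_point_iff_motion[OF p] using deriv[of _ _ s t] by simp
  qed
  have "\<exists>!st. st \<in> {0<..} \<times> {0<..} \<and> y 1 4 + (a * y 1 3) * snd st = fst st * (d * y 2 5 + (f * y 3 5) * snd st) \<and>
     y 2 4 + (c * y 2 5) * fst st = snd st * (b * y 1 3 + (g * y 3 5) * fst st)"
    using pos y by (intro coupled_fixed_point_unique) simp_all
  then show ?thesis
    unfolding crit K_def L_def by simp
qed

end
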